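(* The minimum of $\mathcal{L}$ over graphs of order $15$ is not attained by $K_{7,8}$. Indeed \[ \mathcal{L}\big(C_5[\overline{K_3}]\big)=\frac{63977511069907}{43503039787261205233506826321920000000000}=1.4706\ldots\times 10^{-27}, \] while \[ \mathcal{L}(K_{7,8})=\frac{7628328998218493}{1044072954894268925604163831726080000000000}=7.3063\ldots\times 10^{-27}, \] so that \[ \frac{\mathcal{L}(C_5[\overline{K_3}])}{\mathcal{L}(K_{7,8})}=\frac{1535460265677768}{7628328998218493}=0.20128\ldots<1. \]
   Context: Graphs are finite, simple and undirected. Uniform sequential attachment process: $G_1=K_1$, and for $t\ge 2$ the random graph $G_t$ is obtained from $G_{t-1}$ (which has $t-1$ vertices) as follows: choose $k$ uniformly from $\{0,1,\dots,t-1\}$, then choose a $k$-element subset $W$ of $V(G_{t-1})$ uniformly at random, then add a new vertex adjacent to exactly the vertices of $W$; all choices are independent across steps. For a graph $G$ on $n$ vertices, its likelihood is $\mathcal{L}(G)=\Pr[G_n\cong G]$. $K_{a,b}$ is the complete bipartite graph with parts of sizes $a$ and $b$. $C_5$ is the cycle on five vertices, and $H[\overline{K_m}]$ denotes the blow-up of $H$ in which every vertex is replaced by an independent set of size $m$, two vertices in different independent sets being adjacent if and only if the corresponding vertices of $H$ are adjacent. *)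

theory Defs
  imports "HOL-Probability.Probability"
begin

record 'a graph =
  verts :: "'a set"
  edges :: "'a set set"

definition simple_graph :: "'a graph \<Rightarrow> bool" where
  "simple_graph G \<longleftrightarrow> finite (verts G) \<and> (\<forall>e\<in>edges G. e \<subseteq> verts G \<and> card e = 2)"

definition order :: "'a graph \<Rightarrow> nat" where
  "order G = card (verts G)"

definition isomorphic :: "'a graph \<Rightarrow> 'b graph \<Rightarrow> bool" where
  "isomorphic G H \<longleftrightarrow>
     (\<exists>f. bij_betw f (verts G) (verts H) \<and>
          (\<forall>u\<in>verts G. \<forall>v\<in>verts G. {u, v} \<in> edges G \<longleftrightarrow> {f u, f v} \<in> edges H))"

definition add_vertex :: "'a \<Rightarrow> 'a set \<Rightarrow> 'a graph \<Rightarrow> 'a graph" where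
  "add_vertex v W G =
     \<lparr>verts = insert v (verts G), edges = edges G \<union> (\<lambda>w. {v, w}) ` W\<rparr>"

text \<open>The distribution of \<open>G\<^sub>t\<close>, realised on the vertex set \<open>{..<t}\<close>; the vertex added to
  \<open>G\<^sub>t\<close> is \<open>t\<close>. The process starts at time \<open>1\<close>; the value at time \<open>0\<close> (the empty graph) is
  only there to make the function total.\<close>

fun attachment_process :: "nat \<Rightarrow> nat graph pmf" where
  "attachment_process 0 = return_pmf \<lparr>verts = {}, edges = {}\<rparr>"
| "attachment_process (Suc 0) = return_pmf \<lparr>verts = {0}, edges = {}\<rparr>"
| "attachment_process (Suc (Suc n)) =
     do {
       G \<leftarrow> attachment_process (Suc n);
       k \<leftarrow> pmf_of_set {0..Suc n};
       W \<leftarrow> pmf_of_set {W. W \<subseteq> verts G \<and> card W = k};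
       return_pmf (add_vertex (Suc n) W G)
     }"

definition likelihood :: "'a graph \<Rightarrow> real" where
  "likelihood G = measure_pmf.prob (attachment_process (order G)) {H. isomorphic H G}"

definition complete_bipartite :: "nat \<Rightarrow> nat \<Rightarrow> nat graph" where
  "complete_bipartite a b =
     \<lparr>verts = {..<a + b}, edges = {{i, j} | i j. i < a \<and> a \<le> j \<and> j < a + b}\<rparr>"

text \<open>This is the cycle on \<open>n\<close> vertices only for \<open>n \<ge> 3\<close>.\<close>

definition cycle_graph :: "nat \<Rightarrow> nat graph" where
  "cycle_graph n = \<lparr>verts = {..<n}, edges = {{i, Suc i mod n} | i. i < n}\<rparr>"

text \<open>The blow-up of \<open>H\<close> by independent sets of size \<open>m\<close>. If \<open>H\<close> is simple then
  \<open>{u, u} \<notin> edges H\<close>, so each \<open>{u} \<times> {..<m}\<close> is independent.\<close>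

definition blow_up :: "'a graph \<Rightarrow> nat \<Rightarrow> ('a \<times> nat) graph" where
  "blow_up H m =
     \<lparr>verts = verts H \<times> {..<m},
      edges = {{(u, i), (v, j)} | u v i j. {u, v} \<in> edges H \<and> i < m \<and> j < m}\<rparr>"

end

theory Submission
  imports Defs "HOL-Combinatorics.Multiset_Permutations"
begin

text \<open>
  Given the sequence of back-degrees \<open>d\<^sub>t\<close>, where \<open>d\<^sub>t\<close> is the number of
  neighbours that the vertex \<open>t\<close> chooses among the \<open>t\<close> older ones, the process produces a
  given labelled graph on \<open>{..<n}\<close> with probability
  \<open>\<Prod>t<n. 1 / ((t + 1) * (t choose d\<^sub>t))\<close>. Multiplied by \<open>1! * 2! * \<dots> * n!\<close>, this becomes
  the integer \<open>\<Prod>t<n. d\<^sub>t! * (t - d\<^sub>t)!\<close> (\<open>pmf_history_graph\<close>). The likelihood of \<open>G\<close> is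
  the sum of these probabilities over all labelled graphs isomorphic to \<open>G\<close>.

  Both graphs in question are blow-ups of a small pattern \<open>R\<close> (an edge, or the 5-cycle), so
  their labellings can be described by words: the word records, for each vertex of \<open>{..<n}\<close>,
  the vertex of the pattern whose class it belongs to, and the multiset \<open>M\<close> of letters is
  prescribed by the class sizes. Every word yields a labelled graph, and every labelled copy of
  \<open>G\<close> arises in this way (\<open>support_isomorphic_eq_histories\<close>). If no two vertices of the
  pattern have the same neighbours, a labelled graph determines its partition into classes, as
  the partition into sets of vertices with equal neighbourhoods; two words yield the same graph
  exactly when they differ by a symmetry of the pattern that respects the class sizes
  (\<open>same_history_graph_iff\<close>). Summing over words therefore counts each labelled copy equally
  often, namely once for \<open>K\<^bsub>7,8\<^esub>\<close>, whose two classes have different sizes, and ten times for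
  the blown-up 5-cycle. This gives \<open>likelihood_coloured\<close>:
  the likelihood of \<open>G\<close>, times the number of symmetries, times \<open>1! * \<dots> * n!\<close>, is the
  integer obtained by summing \<open>\<Prod>t<n. d\<^sub>t! * (t - d\<^sub>t)!\<close> over all words with letters \<open>M\<close>.

  Back-degrees depend only on how often each letter has occurred so far. Splitting off the
  newest letter thus gives a recursion over vectors of letter counts, with only 72 vectors for
  \<open>K\<^bsub>7,8\<^esub>\<close> and 1024 for the blown-up 5-cycle. It is evaluated from the full vector downwards, one
  letter at a time, in exact integer arithmetic (\<open>total_history_weight_by_peeling\<close>).

  The value for the blown-up 5-cycle is the smaller one. A copy of this graph on natural numbers has
  the same letters and the same pattern, hence the same likelihood, and it shows that
  \<open>K\<^bsub>7,8\<^esub>\<close> does not attain the minimum.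
\<close>

section \<open>Probabilities of labelled graphs\<close>

lemma simple_graph_eqI:
  assumes "simple_graph G" "simple_graph H" "verts G = verts H"
    and "\<And>u v. u \<in> verts H \<Longrightarrow> v \<in> verts H \<Longrightarrow> {u, v} \<in> edges G \<longleftrightarrow> {u, v} \<in> edges H"
  shows "G = (H :: 'a graph)"
proof -
  have "e \<in> edges G \<longleftrightarrow> e \<in> edges H" if "e \<subseteq> verts H" "card e = 2" for e
    using that assms(4) by (auto simp: card_2_iff)
  moreover have "e \<subseteq> verts H \<and> card e = 2" if "e \<in> edges G \<or> e \<in> edges H" for e
    using that assms(1-3) by (auto simp: simple_graph_def)
  ultimately have "edges G = edges H" by blast
  then show ?thesis using assms(3) by simp
qed

lemma simple_graph_add_vertex:
  assumes "simple_graph G" "v \<notin> verts G" "W \<subseteq> verts G"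
  shows "simple_graph (add_vertex v W G)"
  using assms by (force simp: simple_graph_def add_vertex_def card_insert_if)

text \<open>The new vertex tells the two kinds of edges apart, so one step of the process loses no
  information. Hence the probability of a labelled graph is a product over the steps.\<close>

lemma inj_on_add_vertex:
  "inj_on (\<lambda>(G, W). add_vertex v W G)
     ({G. simple_graph G \<and> verts G = V} \<times> Pow V)" if "v \<notin> V"
proof (rule inj_onI, clarsimp)
  fix G W H U
  assume G: "simple_graph G" "verts H = verts G" "V = verts G" "W \<subseteq> verts G"
    and H: "simple_graph H" "U \<subseteq> verts G"
    and eq: "add_vertex v W G = add_vertex v U H"
  have old: "e \<in> edges (add_vertex v W' G') \<and> v \<notin> e \<longleftrightarrow> e \<in> edges G'"
    if "simple_graph G'" "verts G' = V" for W' and G' :: "'a graph" and e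
    using that \<open>v \<notin> V\<close> by (auto simp: simple_graph_def add_vertex_def)
  have new: "w \<in> W' \<longleftrightarrow> {v, w} \<in> edges (add_vertex v W' G')"
    if "simple_graph G'" "verts G' = V" for W' and G' :: "'a graph" and w
    using that \<open>v \<notin> V\<close> by (auto simp: simple_graph_def add_vertex_def doubleton_eq_iff)
  have "edges G = {e \<in> edges (add_vertex v W G). v \<notin> e}"
    "edges H = {e \<in> edges (add_vertex v U H). v \<notin> e}"
    using old[of G _ W] old[of H _ U] G H by auto
  then have "edges G = edges H" using eq by simp
  moreover have "W = {w. {v, w} \<in> edges (add_vertex v W G)}"
    "U = {w. {v, w} \<in> edges (add_vertex v U H)}"
    using new[of G _ W] new[of H _ U] G H by auto
  then have "W = U" using eq by simp
  ultimately show "G = H \<and> W = U" using G by simp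
qed

text \<open>The distribution of the neighbourhood of the new vertex. It depends on the current graph only
  through its vertex set, which is deterministic; so the neighbourhood is independent of the graph.\<close>

definition attachment_set :: "nat set \<Rightarrow> nat set pmf" where
  "attachment_set V = do {k \<leftarrow> pmf_of_set {0..card V}; pmf_of_set {W. W \<subseteq> V \<and> card W = k}}"

lemma attachment_candidates:
  assumes "finite V" "k \<le> card V"
  shows "finite {W. W \<subseteq> V \<and> card W = k}" "{W. W \<subseteq> V \<and> card W = k} \<noteq> {}"
  using assms obtain_subset_with_card_n[of k V] by auto

lemma set_pmf_attachment_set:
  assumes "finite V"
  shows "set_pmf (attachment_set V) = Pow V"
  using assms attachment_candidates[OF assms]
  by (auto simp: attachment_set_def card_mono)

lemma pmf_attachment_set:
  assumes "finite V" "W \<subseteq> V"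
  shows "pmf (attachment_set V) W = 1 / (real (card V + 1) * real (card V choose card W))"
proof -
  have le: "card W \<le> card V" using assms by (simp add: card_mono)
  have eq: "pmf (pmf_of_set {U. U \<subseteq> V \<and> card U = k}) W
              = (if k = card W then 1 / real (card V choose card W) else 0)"
    if "k \<in> {0..card V}" for k
    using that assms attachment_candidates[OF assms(1), of k]
    by (auto simp: n_subsets)
  have "pmf (attachment_set V) W
      = (\<Sum>k\<in>{0..card V}. pmf (pmf_of_set {U. U \<subseteq> V \<and> card U = k}) W) / (card V + 1)"
    unfolding attachment_set_def by (simp add: pmf_bind integral_pmf_of_set)
  also have "\<dots> = 1 / real (card V choose card W) / (card V + 1)"
    using le by (simp add: eq sum.delta del: pmf_of_set)
  finally show ?thesis by (simp add: mult.commute)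
qed

text \<open>The recursion of the process also holds for the step from the empty graph to the
  one-vertex graph, because the empty neighbourhood is then the only choice. Inductions can
  therefore start at the empty graph.\<close>

lemma attachment_process_Suc_raw:
  "attachment_process (Suc n) = do {
     G \<leftarrow> attachment_process n;
     k \<leftarrow> pmf_of_set {0..n};
     W \<leftarrow> pmf_of_set {W. W \<subseteq> verts G \<and> card W = k};
     return_pmf (add_vertex n W G)}"
proof (cases n)
  case 0
  have "{W. W \<subseteq> {} \<and> card W = 0} = {{} :: nat set}" by auto
  then show ?thesis
    using 0 by (simp add: bind_return_pmf pmf_of_set_singleton add_vertex_def)
qed simp

lemma set_pmf_attachment_process:
  assumes "H \<in> set_pmf (attachment_process n)"
  shows "simple_graph H \<and> verts H = {..<n}"
  using assms
proof (induction n arbitrary: H)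
  case 0
  then show ?case by (simp add: simple_graph_def)
next
  case (Suc n)
  obtain G k W where G: "G \<in> set_pmf (attachment_process n)" "k \<le> n"
    and W: "W \<in> set_pmf (pmf_of_set {W. W \<subseteq> verts G \<and> card W = k})"
    and H: "H = add_vertex n W G"
    using Suc.prems unfolding attachment_process_Suc_raw by auto
  have IH: "simple_graph G" "verts G = {..<n}" using Suc.IH[OF G(1)] by auto
  have "W \<subseteq> verts G"
    using W attachment_candidates[of "verts G" k] IH G(2) by auto
  then show ?case
    using IH simple_graph_add_vertex[of G n W] by (auto simp: H add_vertex_def)
qed

lemma attachment_process_Suc:
  "attachment_process (Suc n) =
     map_pmf (\<lambda>(G, W). add_vertex n W G)
       (pair_pmf (attachment_process n) (attachment_set {..<n}))"
  unfolding attachment_process_Suc_raw pair_pmf_def map_bind_pmf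
proof (rule bind_pmf_cong[OF refl])
  fix G assume "G \<in> set_pmf (attachment_process n)"
  then have "verts G = {..<n}" by (simp add: set_pmf_attachment_process)
  then show "do {k \<leftarrow> pmf_of_set {0..n}; W \<leftarrow> pmf_of_set {W. W \<subseteq> verts G \<and> card W = k};
                 return_pmf (add_vertex n W G)} =
             bind_pmf (attachment_set {..<n})
               (\<lambda>W. map_pmf (\<lambda>(G, W). add_vertex n W G) (return_pmf (G, W)))"
    by (simp add: attachment_set_def bind_assoc_pmf)
qed

lemma pmf_attachment_process_Suc:
  assumes "G \<in> set_pmf (attachment_process n)" "W \<subseteq> {..<n}"
  shows "pmf (attachment_process (Suc n)) (add_vertex n W G) =
           pmf (attachment_process n) G / (real (n + 1) * real (n choose card W))"
proof -
  let ?D = "pair_pmf (attachment_process n) (attachment_set {..<n})"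
  have "inj_on (\<lambda>(G, W). add_vertex n W G) (set_pmf ?D)"
    by (rule inj_on_subset[OF inj_on_add_vertex[of n "{..<n}"]])
       (auto simp: set_pmf_attachment_set dest!: set_pmf_attachment_process)
  moreover have "(G, W) \<in> set_pmf ?D" using assms by (simp add: set_pmf_attachment_set)
  ultimately have "pmf (map_pmf (\<lambda>(G, W). add_vertex n W G) ?D) (add_vertex n W G) = pmf ?D (G, W)"
    using pmf_map_inj[of "\<lambda>(G, W). add_vertex n W G" ?D "(G, W)"] by simp
  then have "pmf (attachment_process (Suc n)) (add_vertex n W G)
      = pmf (attachment_process n) G * pmf (attachment_set {..<n}) W"
    by (simp only: attachment_process_Suc pmf_pair)
  then show ?thesis using assms by (simp add: pmf_attachment_set)
qed

text \<open>A history is the word of the classes of the vertices, with the newest vertex at the head; the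
  vertex \<open>i\<close> carries the letter \<open>rev w ! i\<close>. Listing the newest vertex first makes one step of
  the process one \<open>Cons\<close>.\<close>

primrec history_graph :: "('c \<Rightarrow> 'c \<Rightarrow> bool) \<Rightarrow> 'c list \<Rightarrow> nat graph" where
  "history_graph R [] = \<lparr>verts = {}, edges = {}\<rparr>"
| "history_graph R (x # w) =
     add_vertex (length w) {i. i < length w \<and> R x (rev w ! i)} (history_graph R w)"

text \<open>The factors \<open>d! * (t - d)!\<close> replace the probabilities \<open>1 / ((t + 1) * (t choose d))\<close>: the
  two differ by \<open>(t + 1)!\<close>, which does not depend on the word.\<close>

primrec history_weight :: "('c \<Rightarrow> 'c \<Rightarrow> bool) \<Rightarrow> 'c list \<Rightarrow> nat" where
  "history_weight R [] = 1"
| "history_weight R (x # w) = history_weight R w *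
     (fact (length (filter (R x) w)) * fact (length w - length (filter (R x) w)))"

lemma history_weight_pos: "history_weight R w > 0"
  by (induction w) auto

lemma verts_history_graph [simp]: "verts (history_graph R w) = {..<length w}"
  by (induction w) (simp_all add: add_vertex_def lessThan_Suc)

lemma edges_history_graph:
  assumes "symp R" "irreflp R"
  shows "{i, j} \<in> edges (history_graph R w) \<longleftrightarrow>
           i < length w \<and> j < length w \<and> R (rev w ! i) (rev w ! j)"
proof (induction w)
  case (Cons x w)
  have "{i, j} \<in> edges (history_graph R (x # w)) \<longleftrightarrow>
      {i, j} \<in> edges (history_graph R w) \<or>
      i = length w \<and> j < length w \<and> R x (rev w ! j) \<or>
      j = length w \<and> i < length w \<and> R x (rev w ! i)"
    by (auto simp: add_vertex_def doubleton_eq_iff)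
  moreover have "R (rev w ! k) x \<longleftrightarrow> R x (rev w ! k)" "\<not> R x x" for k
    using assms by (auto dest: sympD irreflpD)
  ultimately show ?case
    unfolding Cons.IH
    by (cases "i = length w"; cases "j = length w")
       (simp_all add: nth_append less_Suc_eq cong: conj_cong)
qed simp

text \<open>One step multiplies the probability by \<open>1 / ((n + 1) * (n choose d))\<close>, and
  \<open>(n + 1)! / ((n + 1) * (n choose d)) = d! * (n - d)!\<close>. The weights are positive, so
  each history graph lies in the support, where a step can be undone.\<close>

lemma pmf_history_graph:
  "pmf (attachment_process (length w)) (history_graph R w) * (\<Prod>t=1..length w. fact t)
     = history_weight R w"
proof (induction w)
  case (Cons x w)
  define n d where "n = length w" and "d = length (filter (R x) w)"
  let ?W = "{i. i < n \<and> R x (rev w ! i)}"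
  have "pmf (attachment_process n) (history_graph R w) \<noteq> 0"
    using Cons.IH history_weight_pos[of R w] by (auto simp: n_def)
  then have supp: "history_graph R w \<in> set_pmf (attachment_process n)"
    by (simp add: set_pmf_iff)
  have W: "?W \<subseteq> {..<n}" by auto
  have card: "card ?W = d"
    using length_filter_conv_card[of "R x" "rev w"]
    by (simp add: n_def d_def flip: rev_filter)
  have "d \<le> n" by (simp add: n_def d_def)
  then have "fact n = fact d * fact (n - d) * (n choose d)"
    by (rule binomial_fact_lemma[symmetric])
  then have "real (fact (Suc n)) = real ((n + 1) * (fact d * fact (n - d) * (n choose d)))"
    by simp
  then have fact: "real (fact (Suc n)) = real (n + 1) * real (n choose d) * (fact d * fact (n - d))"
    by (simp only: of_nat_mult of_nat_fact mult_ac)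
  have "pmf (attachment_process (length (x # w))) (history_graph R (x # w))
      = pmf (attachment_process n) (history_graph R w) / (real (n + 1) * real (n choose d))"
    using pmf_attachment_process_Suc[OF supp W] card by (simp add: n_def)
  moreover have "(\<Prod>t=1..length (x # w). fact t) = (\<Prod>t=1..n. fact t) * real (fact (Suc n))"
    by (simp add: n_def del: fact_Suc)
  moreover have "real (n + 1) * real (n choose d) \<noteq> 0" using \<open>d \<le> n\<close> by simp
  ultimately have "pmf (attachment_process (length (x # w))) (history_graph R (x # w)) *
        (\<Prod>t=1..length (x # w). fact t)
      = (pmf (attachment_process n) (history_graph R w) * (\<Prod>t=1..n. fact t)) *
        (fact d * fact (n - d))"
    unfolding fact by (simp del: of_nat_eq_0_iff mult_eq_0_iff)
  also have "\<dots> = real (history_weight R w) * (fact d * fact (n - d))"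
    by (simp only: Cons.IH n_def)
  also have "\<dots> = real (history_weight R (x # w))"
    by (simp add: n_def d_def)
  finally show ?case .
qed simp

lemma history_graph_in_support: "history_graph R w \<in> set_pmf (attachment_process (length w))"
  using pmf_history_graph[of w R] history_weight_pos[of R w]
  by (auto simp: set_pmf_iff)

section \<open>Labelled copies of a blow-up\<close>

text \<open>\<open>G\<close> is the blow-up of the pattern \<open>R\<close> in which the class of the pattern vertex \<open>x\<close> has
  \<open>count M x\<close> elements; \<open>c\<close> sends each vertex to its class.\<close>

definition coloured_by :: "('c \<Rightarrow> 'c \<Rightarrow> bool) \<Rightarrow> 'c multiset \<Rightarrow> 'a graph \<Rightarrow> bool" where
  "coloured_by R M G \<longleftrightarrow> finite (verts G) \<and>
     (\<exists>c. image_mset c (mset_set (verts G)) = M \<and>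
          (\<forall>u\<in>verts G. \<forall>v\<in>verts G. {u, v} \<in> edges G \<longleftrightarrow> R (c u) (c v)))"

lemma coloured_byI:
  assumes "finite (verts G)" "\<And>i. card {v \<in> verts G. c v = i} = count M i"
    and "\<And>u v. u \<in> verts G \<Longrightarrow> v \<in> verts G \<Longrightarrow> {u, v} \<in> edges G \<longleftrightarrow> R (c u) (c v)"
  shows "coloured_by R M G"
proof -
  have "image_mset c (mset_set (verts G)) = M"
    using assms(1,2) by (intro multiset_eqI) (simp add: count_image_mset_eq_card_vimage)
  then show ?thesis using assms unfolding coloured_by_def by blast
qed

lemma mset_rev_nth: "image_mset ((!) (rev w)) (mset_set {..<length w}) = mset w"
  by (metis length_rev lessThan_atLeast0 map_nth mset_map mset_rev mset_upt)

lemma coloured_by_history_graph: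
  assumes "symp R" "irreflp R" "mset w = M"
  shows "coloured_by R M (history_graph R w)"
  unfolding coloured_by_def
  using assms by (auto intro!: exI[of _ "(!) (rev w)"] simp: edges_history_graph mset_rev_nth)

text \<open>Likelihoods of blow-ups depend only on \<open>R\<close> and \<open>M\<close>. A copy on natural
  numbers thus turns a value computed for the vertex type of a blow-up into a value for a graph of
  the type over which the minimum is taken.\<close>

lemma ex_nat_graph_coloured_by:
  assumes "symp R" "irreflp R"
  shows "\<exists>G :: nat graph. simple_graph G \<and> order G = size M \<and> coloured_by R M G"
proof -
  obtain w where w: "mset w = M" using ex_mset by blast
  then have "length w = size M" by auto
  then show ?thesis
    using coloured_by_history_graph[OF assms w] history_graph_in_support[of R w]
    by (intro exI[of _ "history_graph R w"])
       (simp add: order_def set_pmf_attachment_process)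
qed

text \<open>An isomorphism from a labelled graph to \<open>G\<close>, composed with the class map, is a history;
  conversely, two class maps with the same class sizes differ by a bijection of the vertices, and
  this bijection is an isomorphism.\<close>

lemma support_isomorphic_eq_histories:
  assumes R: "symp R" "irreflp R" and G: "coloured_by R M G"
  shows "{H. isomorphic H G} \<inter> set_pmf (attachment_process (size M))
           = history_graph R ` permutations_of_multiset M"
proof -
  let ?V = "verts G" and ?n = "size M"
  obtain c where fin: "finite ?V" and c: "image_mset c (mset_set ?V) = M"
    and E: "\<And>u v. u \<in> ?V \<Longrightarrow> v \<in> ?V \<Longrightarrow> {u, v} \<in> edges G \<longleftrightarrow> R (c u) (c v)"
    using G unfolding coloured_by_def by auto
  have n: "card ?V = ?n" using c by (metis size_image_mset size_mset_set)
  show ?thesis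
  proof (intro equalityI subsetI)
    fix H assume "H \<in> {H. isomorphic H G} \<inter> set_pmf (attachment_process ?n)"
    then have H: "simple_graph H" "verts H = {..<?n}" and "isomorphic H G"
      by (auto dest: set_pmf_attachment_process)
    then obtain f where f: "bij_betw f {..<?n} ?V"
      and fE: "\<And>u v. u < ?n \<Longrightarrow> v < ?n \<Longrightarrow> {u, v} \<in> edges H \<longleftrightarrow> {f u, f v} \<in> edges G"
      by (auto simp: isomorphic_def)
    define w where "w = rev (map (c \<circ> f) [0..<?n])"
    have "mset w = image_mset c (image_mset f (mset_set {..<?n}))"
      by (simp add: w_def lessThan_atLeast0 multiset.map_comp)
    also have "\<dots> = M" using f c by (simp add: image_mset_mset_set bij_betw_def)
    finally have w: "mset w = M" .
    have "H = history_graph R w"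
    proof (rule simple_graph_eqI)
      show "simple_graph (history_graph R w)"
        using history_graph_in_support set_pmf_attachment_process by blast
      show "{u, v} \<in> edges H \<longleftrightarrow> {u, v} \<in> edges (history_graph R w)"
        if "u \<in> verts (history_graph R w)" "v \<in> verts (history_graph R w)" for u v
        using that bij_betwE[OF f] by (simp add: edges_history_graph[OF R] fE E w_def)
    qed (use H in \<open>auto simp: w_def\<close>)
    then show "H \<in> history_graph R ` permutations_of_multiset M"
      using w by (auto simp: permutations_of_multiset_def)
  next
    fix H assume "H \<in> history_graph R ` permutations_of_multiset M"
    then obtain w where w: "mset w = M" and H: "H = history_graph R w"
      by (auto simp: permutations_of_multiset_def)
    have len: "length w = ?n" using w by auto
    obtain f where f: "bij_betw f {..<?n} ?V"
      using ex_bij_betw_nat_finite[OF fin] by (auto simp: n lessThan_atLeast0)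
    have "image_mset ((!) (rev w)) (mset_set {..<?n}) = M"
      using mset_rev_nth[of w] by (simp add: w len)
    also have "\<dots> = image_mset c (image_mset f (mset_set {..<?n}))"
      using f c by (simp add: image_mset_mset_set bij_betw_def)
    also have "\<dots> = image_mset (c \<circ> f) (mset_set {..<?n})"
      by (simp add: multiset.map_comp)
    finally obtain p where p: "p permutes {..<?n}" and cp: "\<forall>i\<in>{..<?n}. rev w ! i = (c \<circ> f) (p i)"
      by (rule image_mset_eq_implies_permutes[rotated]) auto
    have fp: "bij_betw (f \<circ> p) {..<?n} ?V"
      using bij_betw_trans[OF permutes_imp_bij[OF p] f] .
    have "isomorphic H G"
      unfolding isomorphic_def H
      using fp bij_betwE[OF fp] cp
      by (intro exI[of _ "f \<circ> p"]) (auto simp: edges_history_graph[OF R] len E)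
    then show "H \<in> {H. isomorphic H G} \<inter> set_pmf (attachment_process ?n)"
      using history_graph_in_support[of R w] by (simp add: H len)
  qed
qed

text \<open>The automorphisms of the pattern that preserve class sizes. They are the identity outside the
  pattern, so that they can be counted.\<close>

definition pattern_symmetries :: "('c \<Rightarrow> 'c \<Rightarrow> bool) \<Rightarrow> 'c multiset \<Rightarrow> ('c \<Rightarrow> 'c) set" where
  "pattern_symmetries R M =
     {\<pi>. \<pi> permutes set_mset M \<and> image_mset \<pi> M = M \<and>
         (\<forall>x\<in>#M. \<forall>y\<in>#M. R (\<pi> x) (\<pi> y) \<longleftrightarrow> R x y)}"

definition twin_free_on :: "'c set \<Rightarrow> ('c \<Rightarrow> 'c \<Rightarrow> bool) \<Rightarrow> bool" where
  "twin_free_on A R \<longleftrightarrow> (\<forall>x\<in>A. \<forall>y\<in>A. (\<forall>z\<in>A. R x z \<longleftrightarrow> R y z) \<longrightarrow> x = y)"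

lemma history_graph_map:
  assumes "\<And>x y. x \<in> set w \<Longrightarrow> y \<in> set w \<Longrightarrow> R (\<pi> x) (\<pi> y) \<longleftrightarrow> R x y"
  shows "history_graph R (map \<pi> w) = history_graph R w"
  using assms
proof (induction w)
  case (Cons x w)
  have "R (\<pi> x) (rev (map \<pi> w) ! i) \<longleftrightarrow> R x (rev w ! i)" if "i < length w" for i
  proof -
    have "rev w ! i \<in> set w" using that by (metis length_rev nth_mem set_rev)
    then show ?thesis using that Cons.prems by (simp add: rev_map)
  qed
  then have "{i. i < length w \<and> R (\<pi> x) (rev (map \<pi> w) ! i)}
      = {i. i < length w \<and> R x (rev w ! i)}" by blast
  then show ?case using Cons by simp
qed simp

lemma nth_image_lessThan: "(!) xs ` {..<length xs} = set xs"
  by (auto simp: set_conv_nth)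

text \<open>Without twins in the pattern, two vertices of the graph belong to the same class iff they have the
  same neighbours. So two histories of the same graph induce the same partition into classes, and
  they differ only by a renaming of the classes. The renaming preserves adjacency, because both
  histories describe the same edges, and class sizes, because both have the letters \<open>M\<close>.\<close>

lemma same_history_graph_iff:
  assumes R: "symp R" "irreflp R" and tf: "twin_free_on (set_mset M) R" and w: "mset w = M"
  shows "{w' \<in> permutations_of_multiset M. history_graph R w' = history_graph R w}
           = (\<lambda>\<pi>. map \<pi> w) ` pattern_symmetries R M"
proof (intro equalityI subsetI)
  fix v assume "v \<in> (\<lambda>\<pi>. map \<pi> w) ` pattern_symmetries R M"
  then show "v \<in> {w' \<in> permutations_of_multiset M. history_graph R w' = history_graph R w}"
    using w by (auto simp: pattern_symmetries_def permutations_of_multiset_def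
        intro!: history_graph_map)
next
  fix v assume "v \<in> {w' \<in> permutations_of_multiset M. history_graph R w' = history_graph R w}"
  then have v: "mset v = M" and eq: "history_graph R v = history_graph R w"
    by (auto simp: permutations_of_multiset_def)
  let ?I = "set_mset M"
  have I: "set v = ?I" "set w = ?I" using v w by (metis set_mset_mset)+
  define n where "n = length w"
  have len: "length v = n" "length w = n" using v w unfolding n_def by (metis size_mset)+
  define a b where "a = (!) (rev v)" and "b = (!) (rev w)"
  have aI: "a ` {..<n} = ?I" and bI: "b ` {..<n} = ?I"
    using nth_image_lessThan[of "rev v"] nth_image_lessThan[of "rev w"] I len
    by (simp_all add: a_def b_def)
  have adj: "R (a i) (a j) \<longleftrightarrow> R (b i) (b j)" if "i < n" "j < n" for i j
  proof -
    have "{i, j} \<in> edges (history_graph R v) \<longleftrightarrow> {i, j} \<in> edges (history_graph R w)"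
      by (simp only: eq)
    then show ?thesis
      unfolding edges_history_graph[OF R] len a_def b_def by (simp only: that simp_thms)
  qed
  have separated: "c i = c j \<longleftrightarrow> (\<forall>k<n. R (c i) (c k) \<longleftrightarrow> R (c j) (c k))"
    if c: "c ` {..<n} = ?I" and ij: "i < n" "j < n" for c i j
  proof
    assume "\<forall>k<n. R (c i) (c k) \<longleftrightarrow> R (c j) (c k)"
    then have "\<forall>z\<in>?I. R (c i) z \<longleftrightarrow> R (c j) z"
      unfolding c[symmetric] by simp
    moreover have "c i \<in> ?I" "c j \<in> ?I"
      unfolding c[symmetric] using ij by simp_all
    ultimately show "c i = c j"
      using tf unfolding twin_free_on_def by simp
  qed simp
  have ker: "a i = a j \<longleftrightarrow> b i = b j" if "i < n" "j < n" for i j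
    unfolding separated[OF aI that] separated[OF bI that] using adj that by simp
  \<comment> \<open>The class \<open>x\<close> of \<open>w\<close> is renamed to the class that \<open>v\<close> gives to any of its members.\<close>
  define \<pi> where "\<pi> x = (if x \<in> ?I then a (inv_into {..<n} b x) else x)" for x
  have \<pi>: "\<pi> (b i) = a i" if "i < n" for i
  proof -
    let ?j = "inv_into {..<n} b (b i)"
    have "?j < n" "b ?j = b i"
      using that inv_into_into[of "b i" b "{..<n}"] f_inv_into_f[of "b i" b "{..<n}"] by auto
    then show ?thesis using ker[of ?j i] that bI by (auto simp: \<pi>_def)
  qed
  have "inj_on \<pi> ?I"
    unfolding bI[symmetric] by (rule inj_onI) (auto simp: \<pi> ker)
  moreover have "\<pi> ` ?I = ?I"
    using aI \<pi> unfolding bI[symmetric] by (force simp: image_image)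
  ultimately have perm: "\<pi> permutes ?I"
    by (intro bij_imp_permutes) (auto simp: bij_betw_def \<pi>_def)
  have map: "map \<pi> w = v"
  proof -
    have "map \<pi> (rev w) = rev v"
      using \<pi> len by (intro nth_equalityI) (auto simp: a_def b_def)
    then show ?thesis by (simp add: rev_map[symmetric])
  qed
  have "image_mset \<pi> M = M" using map v w by (metis mset_map)
  moreover have "R (\<pi> x) (\<pi> y) \<longleftrightarrow> R x y" if "x \<in> ?I" "y \<in> ?I" for x y
    using that adj \<pi> unfolding bI[symmetric] by auto
  ultimately have "\<pi> \<in> pattern_symmetries R M" using perm by (simp add: pattern_symmetries_def)
  then show "v \<in> (\<lambda>\<pi>. map \<pi> w) ` pattern_symmetries R M" using map by blast
qed

lemma card_same_history_graph:
  assumes "symp R" "irreflp R" "twin_free_on (set_mset M) R" "mset w = M"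
  shows "card {w' \<in> permutations_of_multiset M. history_graph R w' = history_graph R w}
           = card (pattern_symmetries R M)"
proof -
  have "inj_on (\<lambda>\<pi>. map \<pi> w) (pattern_symmetries R M)"
  proof (rule inj_onI, rule ext)
    fix \<pi> \<rho> x
    assume "\<pi> \<in> pattern_symmetries R M" "\<rho> \<in> pattern_symmetries R M" "map \<pi> w = map \<rho> w"
    then show "\<pi> x = \<rho> x"
      using assms(4) by (cases "x \<in># M") (auto simp: pattern_symmetries_def permutes_not_in)
  qed
  then show ?thesis by (simp add: same_history_graph_iff[OF assms] card_image)
qed

definition total_history_weight :: "('c \<Rightarrow> 'c \<Rightarrow> bool) \<Rightarrow> 'c multiset \<Rightarrow> nat" where
  "total_history_weight R M = (\<Sum>w\<in>permutations_of_multiset M. history_weight R w)"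

text \<open>Each labelled copy of \<open>G\<close> has as many histories as the pattern has symmetries, so the sum over
  histories is that multiple of the likelihood.\<close>

theorem likelihood_coloured:
  assumes R: "symp R" "irreflp R" "twin_free_on (set_mset M) R" and G: "coloured_by R M G"
  shows "likelihood G * real (card (pattern_symmetries R M)) * (\<Prod>t=1..size M. fact t)
           = total_history_weight R M"
proof -
  let ?P = "permutations_of_multiset M" and ?AP = "attachment_process (size M)"
  have "order G = size M"
    using G by (auto simp: coloured_by_def order_def)
  then have "likelihood G = measure_pmf.prob ?AP ({H. isomorphic H G} \<inter> set_pmf ?AP)"
    unfolding likelihood_def by (simp add: measure_Int_set_pmf)
  also have "\<dots> = (\<Sum>H\<in>history_graph R ` ?P. pmf ?AP H)"
    unfolding support_isomorphic_eq_histories[OF R(1,2) G]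
    by (intro measure_measure_pmf_finite) simp
  finally have "likelihood G * real (card (pattern_symmetries R M))
      = (\<Sum>H\<in>history_graph R ` ?P. \<Sum>w | w \<in> ?P \<and> history_graph R w = H. pmf ?AP H)"
    using card_same_history_graph[OF R]
    by (auto simp: sum_distrib_right permutations_of_multiset_def intro!: sum.cong)
  also have "\<dots> = (\<Sum>H\<in>history_graph R ` ?P.
                    \<Sum>w | w \<in> ?P \<and> history_graph R w = H. pmf ?AP (history_graph R w))"
    by (intro sum.cong) auto
  also have "\<dots> = (\<Sum>w\<in>?P. pmf ?AP (history_graph R w))"
    by (intro sum.image_gen[symmetric]) simp
  finally have "likelihood G * real (card (pattern_symmetries R M)) * (\<Prod>t=1..size M. fact t)
      = (\<Sum>w\<in>?P. pmf ?AP (history_graph R w) * (\<Prod>t=1..size M. fact t))"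
    by (simp add: sum_distrib_right)
  also have "\<dots> = (\<Sum>w\<in>?P. real (history_weight R w))"
  proof (intro sum.cong refl)
    fix w assume "w \<in> ?P"
    then have "length w = size M" by (auto simp: permutations_of_multiset_def)
    then show "pmf ?AP (history_graph R w) * (\<Prod>t=1..size M. fact t) = real (history_weight R w)"
      using pmf_history_graph[of w R] by simp
  qed
  finally show ?thesis by (simp add: total_history_weight_def)
qed

section \<open>Recursion over letter counts\<close>

lemma total_history_weight_empty [simp]: "total_history_weight R {#} = 1"
  by (simp add: total_history_weight_def)

text \<open>The newest vertex can have any letter \<open>x\<close> of \<open>M\<close>. Its back-degree is the number of letters
  adjacent to \<open>x\<close>; counting in \<open>M\<close> instead of \<open>M - {#x#}\<close> makes no difference, because \<open>x\<close> is
  not adjacent to itself.\<close>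

lemma total_history_weight_rec:
  assumes "M \<noteq> {#}" "irreflp R"
  shows "total_history_weight R M =
    (\<Sum>x\<in>set_mset M. let d = size (filter_mset (R x) M) in
       fact d * fact (size M - 1 - d) * total_history_weight R (M - {#x#}))"
proof -
  have "total_history_weight R M =
      (\<Sum>x\<in>set_mset M. \<Sum>w\<in>(#) x ` permutations_of_multiset (M - {#x#}). history_weight R w)"
    unfolding total_history_weight_def permutations_of_multiset_nonempty[OF assms(1)]
    by (intro sum.UNION_disjoint) auto
  also have "\<dots> = (\<Sum>x\<in>set_mset M. let d = size (filter_mset (R x) M) in
       fact d * fact (size M - 1 - d) * total_history_weight R (M - {#x#}))"
  proof (intro sum.cong refl)
    fix x assume x: "x \<in># M"
    define d where "d = size (filter_mset (R x) M)"
    have "\<not> R x x" using assms(2) by (simp add: irreflpD)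
    then have "filter_mset (R x) (M - {#x#}) = filter_mset (R x) M"
      using multi_member_split[OF x] by auto
    then have d: "length (filter (R x) w) = d" if "mset w = M - {#x#}" for w
      using that unfolding d_def by (metis mset_filter size_mset)
    have len: "length w = size M - 1" if "mset w = M - {#x#}" for w
      using that x by (metis size_Diff_singleton size_mset)
    have "(\<Sum>w\<in>(#) x ` permutations_of_multiset (M - {#x#}). history_weight R w)
        = (\<Sum>w\<in>permutations_of_multiset (M - {#x#}). history_weight R (x # w))"
      by (simp add: sum.reindex)
    also have "\<dots> = (\<Sum>w\<in>permutations_of_multiset (M - {#x#}).
        fact d * fact (size M - 1 - d) * history_weight R w)"
      by (intro sum.cong refl) (simp add: permutations_of_multiset_def d len)
    finally show "(\<Sum>w\<in>(#) x ` permutations_of_multiset (M - {#x#}). history_weight R w)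
        = (let d = size (filter_mset (R x) M) in
             fact d * fact (size M - 1 - d) * total_history_weight R (M - {#x#}))"
      by (simp add: total_history_weight_def d_def sum_distrib_left Let_def)
  qed
  finally show ?thesis .
qed

definition letters_of :: "nat list \<Rightarrow> nat multiset" where
  "letters_of s = (\<Sum>i<length s. replicate_mset (s ! i) i)"

lemma count_letters_of: "count (letters_of s) i = (if i < length s then s ! i else 0)"
  by (simp add: letters_of_def count_sum)

lemma set_letters_of: "set_mset (letters_of s) = {i. i < length s \<and> s ! i > 0}"
  by (auto simp: set_mset_def count_letters_of split: if_splits)

lemma size_letters_of: "size (letters_of s) = sum_list s"
  by (simp add: letters_of_def sum_list_sum_nth lessThan_atLeast0)

lemma letters_of_remove:
  assumes "i < length s"
  shows "letters_of s - {#i#} = letters_of (s[i := s ! i - 1])"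
  using assms by (intro multiset_eqI) (simp add: count_letters_of nth_list_update)

text \<open>Patterns on an initial segment of the natural numbers, given by lists of neighbours, so that
  back-degrees can be computed from count vectors.\<close>

definition adjacent_in :: "nat list list \<Rightarrow> nat \<Rightarrow> nat \<Rightarrow> bool" where
  "adjacent_in N i j \<longleftrightarrow> i < length N \<and> j \<in> set (N ! i)"

definition adjacency_lists :: "nat list list \<Rightarrow> bool" where
  "adjacency_lists N \<longleftrightarrow>
     (\<forall>i<length N. distinct (N ! i) \<and> i \<notin> set (N ! i) \<and> set (N ! i) \<subseteq> {..<length N})"

lemma irreflp_adjacent_in: "adjacency_lists N \<Longrightarrow> irreflp (adjacent_in N)"
  by (auto simp: adjacency_lists_def adjacent_in_def irreflp_def)

lemma size_filter_letters_of:
  assumes "distinct J" "set J \<subseteq> {..<length s}"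
  shows "size (filter_mset (\<lambda>j. j \<in> set J) (letters_of s)) = sum_list (map ((!) s) J)"
proof -
  have "size (filter_mset (\<lambda>j. j \<in> A) M) = (\<Sum>j\<in>A. count M j)" if "finite A" for A and M :: "nat multiset"
  proof (induction M)
    case (add x M)
    have "(\<Sum>j\<in>A. count (add_mset x M) j) = (\<Sum>j\<in>A. (if x = j then 1 else 0) + count M j)"
      by (intro sum.cong) auto
    also have "\<dots> = (if x \<in> A then 1 else 0) + (\<Sum>j\<in>A. count M j)"
      using that by (simp add: sum.distrib)
    finally show ?case using add.IH by simp
  qed simp
  then have "size (filter_mset (\<lambda>j. j \<in> set J) (letters_of s)) = (\<Sum>j\<in>set J. count (letters_of s) j)"
    by simp
  also have "\<dots> = (\<Sum>j\<in>set J. s ! j)"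
    using assms(2) by (intro sum.cong) (auto simp: count_letters_of)
  finally show ?thesis using assms(1) by (simp add: sum_list_distinct_conv_sum_set)
qed

text \<open>A table is a formal linear combination of count vectors, which stands for the corresponding
  combination of total weights (\<open>table_sum\<close> below). Tables are kept sorted by \<open>lex_less\<close>, so
  that merging brings equal vectors together and no vector occurs twice.\<close>

fun lex_less :: "nat list \<Rightarrow> nat list \<Rightarrow> bool" where
  "lex_less (x # xs) (y # ys) = (if x = y then lex_less xs ys else x < y)"
| "lex_less _ _ = False"

fun merge_tables :: "(nat list \<times> nat) list \<Rightarrow> (nat list \<times> nat) list \<Rightarrow> (nat list \<times> nat) list" where
  "merge_tables [] Y = Y"
| "merge_tables X [] = X"
| "merge_tables ((s, a) # X) ((t, b) # Y) =
     (if s = t then (s, a + b) # merge_tables X Y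
      else if lex_less s t then (s, a) # merge_tables X ((t, b) # Y)
      else (t, b) # merge_tables ((s, a) # X) Y)"

text \<open>The terms of the recursion that belong to the newest letter \<open>i\<close>, for vectors with \<open>Suc t\<close> letters:
  the newest vertex then has \<open>t\<close> older ones. Removing the same letter from all vectors keeps a
  table sorted.\<close>

fun peel_letter :: "nat list list \<Rightarrow> nat \<Rightarrow> nat \<Rightarrow> (nat list \<times> nat) list \<Rightarrow> (nat list \<times> nat) list" where
  "peel_letter N t i [] = []"
| "peel_letter N t i ((s, a) # X) =
     (if s ! i = 0 then peel_letter N t i X
      else let d = sum_list (map ((!) s) (N ! i))
           in (s[i := s ! i - 1], a * (fact d * fact (t - d))) # peel_letter N t i X)"

definition peel :: "nat list list \<Rightarrow> nat \<Rightarrow> (nat list \<times> nat) list \<Rightarrow> (nat list \<times> nat) list" where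
  "peel N t X = foldr (\<lambda>i. merge_tables (peel_letter N t i X)) [0..<length N] []"

fun peel_all :: "nat list list \<Rightarrow> nat \<Rightarrow> (nat list \<times> nat) list \<Rightarrow> (nat list \<times> nat) list" where
  "peel_all N 0 X = X"
| "peel_all N (Suc t) X = peel_all N t (peel N t X)"

definition table_sum :: "nat list list \<Rightarrow> (nat list \<times> nat) list \<Rightarrow> nat" where
  "table_sum N X = (\<Sum>(s, a)\<leftarrow>X. a * total_history_weight (adjacent_in N) (letters_of s))"

definition count_vectors :: "nat list list \<Rightarrow> nat \<Rightarrow> nat list set" where
  "count_vectors N t = {s. length s = length N \<and> sum_list s = t}"

lemma total_history_weight_letters_of_rec:
  assumes N: "adjacency_lists N" and s: "s \<in> count_vectors N (Suc t)"
  shows "total_history_weight (adjacent_in N) (letters_of s) =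
    (\<Sum>i<length N. if s ! i = 0 then 0 else
       let d = sum_list (map ((!) s) (N ! i)) in
       fact d * fact (t - d) * total_history_weight (adjacent_in N) (letters_of (s[i := s ! i - 1])))"
proof -
  let ?T = "\<lambda>s. total_history_weight (adjacent_in N) (letters_of s)"
  have len: "length s = length N" and sz: "size (letters_of s) = Suc t"
    using s by (auto simp: count_vectors_def size_letters_of)
  then have "letters_of s \<noteq> {#}" by auto
  then have "?T s = (\<Sum>i\<in>set_mset (letters_of s).
      let d = size (filter_mset (adjacent_in N i) (letters_of s)) in
        fact d * fact (t - d) * total_history_weight (adjacent_in N) (letters_of s - {#i#}))"
    using irreflp_adjacent_in[OF N] by (simp add: total_history_weight_rec sz)
  also have "\<dots> = (\<Sum>i\<in>set_mset (letters_of s).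
      let d = sum_list (map ((!) s) (N ! i)) in
        fact d * fact (t - d) * ?T (s[i := s ! i - 1]))"
  proof (intro sum.cong refl)
    fix i assume "i \<in># letters_of s"
    then have i: "i < length N" by (simp add: set_letters_of len)
    then have "adjacent_in N i = (\<lambda>j. j \<in> set (N ! i))"
      by (simp add: adjacent_in_def fun_eq_iff)
    then have "size (filter_mset (adjacent_in N i) (letters_of s)) = sum_list (map ((!) s) (N ! i))"
      using size_filter_letters_of[of "N ! i" s] N i len by (simp add: adjacency_lists_def)
    then show "(let d = size (filter_mset (adjacent_in N i) (letters_of s)) in
          fact d * fact (t - d) * total_history_weight (adjacent_in N) (letters_of s - {#i#}))
        = (let d = sum_list (map ((!) s) (N ! i)) in
          fact d * fact (t - d) * ?T (s[i := s ! i - 1]))"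
      using i by (simp add: letters_of_remove len)
  qed
  also have "\<dots> = (\<Sum>i<length N. if s ! i = 0 then 0 else
       let d = sum_list (map ((!) s) (N ! i)) in fact d * fact (t - d) * ?T (s[i := s ! i - 1]))"
    by (intro sum.mono_neutral_cong_left) (auto simp: set_letters_of len)
  finally show ?thesis .
qed

lemma table_sum_Nil [simp]: "table_sum N [] = 0"
  by (simp add: table_sum_def)

lemma table_sum_Cons [simp]:
  "table_sum N ((s, a) # X) = a * total_history_weight (adjacent_in N) (letters_of s) + table_sum N X"
  by (simp add: table_sum_def)

lemma table_sum_merge_tables: "table_sum N (merge_tables X Y) = table_sum N X + table_sum N Y"
  by (induction X Y rule: merge_tables.induct) (auto simp: algebra_simps)

text \<open>Peeling replaces each count vector by the right-hand side of its recursion.\<close>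

lemma table_sum_peel:
  assumes N: "adjacency_lists N" and X: "fst ` set X \<subseteq> count_vectors N (Suc t)"
  shows "table_sum N (peel N t X) = table_sum N X"
proof -
  have "table_sum N (foldr (\<lambda>i. merge_tables (peel_letter N t i X)) is [])
      = (\<Sum>i\<leftarrow>is. table_sum N (peel_letter N t i X))" for "is"
    by (induction "is") (simp_all add: table_sum_merge_tables)
  then have "table_sum N (peel N t X) = (\<Sum>i<length N. table_sum N (peel_letter N t i X))"
    by (simp add: peel_def interv_sum_list_conv_sum_set_nat lessThan_atLeast0)
  also have "\<dots> = table_sum N X"
    using X
  proof (induction X)
    case (Cons p X)
    obtain s a where p: "p = (s, a)" by (cases p)
    let ?f = "\<lambda>i. if s ! i = 0 then 0 else let d = sum_list (map ((!) s) (N ! i)) in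
       fact d * fact (t - d) * total_history_weight (adjacent_in N) (letters_of (s[i := s ! i - 1]))"
    have "table_sum N (peel_letter N t i (p # X))
        = a * ?f i + table_sum N (peel_letter N t i X)" for i
      by (simp add: p Let_def)
    then have "(\<Sum>i<length N. table_sum N (peel_letter N t i (p # X)))
        = a * (\<Sum>i<length N. ?f i) + (\<Sum>i<length N. table_sum N (peel_letter N t i X))"
      by (simp only: sum.distrib sum_distrib_left)
    also have "(\<Sum>i<length N. ?f i) = total_history_weight (adjacent_in N) (letters_of s)"
      using total_history_weight_letters_of_rec[OF N, of s t] Cons.prems by (simp add: p)
    finally show ?case using Cons by (simp add: p)
  qed simp
  finally show ?thesis .
qed

lemma fst_set_merge_tables: "fst ` set (merge_tables X Y) \<subseteq> fst ` set X \<union> fst ` set Y"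
  by (induction X Y rule: merge_tables.induct) (simp_all, blast)

lemma states_peel_letter:
  assumes "fst ` set X \<subseteq> count_vectors N (Suc t)" "i < length N"
  shows "fst ` set (peel_letter N t i X) \<subseteq> count_vectors N t"
  using assms
proof (induction N t i X rule: peel_letter.induct)
  case (2 N t i s a X)
  have "length s = length N" "sum_list s = Suc t" using 2(3) by (auto simp: count_vectors_def)
  then have "s[i := s ! i - 1] \<in> count_vectors N t" if "s ! i \<noteq> 0"
    using that \<open>i < length N\<close> elem_le_sum_list[of i s]
    by (simp add: count_vectors_def sum_list_update)
  then show ?case using 2 by (auto simp: Let_def)
qed simp

lemma states_peel:
  assumes "fst ` set X \<subseteq> count_vectors N (Suc t)"
  shows "fst ` set (peel N t X) \<subseteq> count_vectors N t"
proof -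
  have "fst ` set (foldr (\<lambda>i. merge_tables (peel_letter N t i X)) is []) \<subseteq> count_vectors N t"
    if "set is \<subseteq> {..<length N}" for "is"
    using that
  proof (induction "is")
    case (Cons i "is")
    have "fst ` set (peel_letter N t i X) \<subseteq> count_vectors N t"
      using Cons.prems by (intro states_peel_letter[OF assms]) simp
    moreover have "fst ` set (foldr (\<lambda>i. merge_tables (peel_letter N t i X)) is []) \<subseteq> count_vectors N t"
      using Cons by simp
    ultimately show ?case
      unfolding foldr.simps comp_def by (intro order_trans[OF fst_set_merge_tables] Un_least)
  qed simp
  then show ?thesis by (simp add: peel_def atLeast0LessThan)
qed

lemma table_sum_peel_all:
  assumes "adjacency_lists N" "fst ` set X \<subseteq> count_vectors N t"
  shows "table_sum N (peel_all N t X) = table_sum N X"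
  using assms(2)
proof (induction t arbitrary: X)
  case (Suc t)
  then show ?case
    using states_peel[OF Suc.prems] table_sum_peel[OF assms(1) Suc.prems] by simp
qed simp

text \<open>When all letters are removed, only the zero vector is left. It stands for the empty word, of weight
  1, so its coefficient is the total weight.\<close>

lemma total_history_weight_by_peeling:
  assumes N: "adjacency_lists N" and s: "length s = length N" "sum_list s = t"
    and final: "peel_all N t [(s, 1)] = [(replicate (length N) 0, v)]"
  shows "total_history_weight (adjacent_in N) (letters_of s) = v"
proof -
  have zero: "letters_of (replicate (length N) 0) = {#}"
    by (simp add: letters_of_def)
  have "total_history_weight (adjacent_in N) (letters_of s) = table_sum N [(s, 1)]"
    by simp
  also have "\<dots> = table_sum N (peel_all N t [(s, 1)])"
    using table_sum_peel_all[OF N, of "[(s, 1)]" t] s by (simp add: count_vectors_def)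
  also have "\<dots> = v"
    unfolding final by (simp add: zero)
  finally show ?thesis .
qed

section \<open>The two patterns\<close>

definition single_edge :: "nat list list" where
  "single_edge = [[1], [0]]"

definition pentagon :: "nat list list" where
  "pentagon = [[1, 4], [0, 2], [1, 3], [2, 4], [3, 0]]"

abbreviation "K2 \<equiv> adjacent_in single_edge"
abbreviation "C5 \<equiv> adjacent_in pentagon"

lemma ball_lessThan_5: "(\<forall>i<5. P i) \<longleftrightarrow> P 0 \<and> P 1 \<and> P 2 \<and> P 3 \<and> P (4::nat)"
  by (auto simp: less_Suc_eq numeral_eq_Suc)

lemma less_5_cases: 
  assumes "i < (5::nat)"
  obtains "i = 0" | "i = 1" | "i = 2" | "i = 3" | "i = 4"
  using assms by (auto simp: less_Suc_eq numeral_eq_Suc)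

lemma lessThan_5: "{..<5} = {0, 1, 2, 3, 4::nat}"
  by auto

lemma K2_iff: "K2 i j \<longleftrightarrow> i = 0 \<and> j = 1 \<or> i = 1 \<and> j = 0"
  by (auto simp: adjacent_in_def single_edge_def less_Suc_eq)

lemma length_pentagon: "length pentagon = 5"
  by (simp add: pentagon_def)

lemma C5_iff:
  "C5 i j \<longleftrightarrow> i = 0 \<and> j \<in> {1, 4} \<or> i = 1 \<and> j \<in> {0, 2} \<or> i = 2 \<and> j \<in> {1, 3} \<or>
     i = 3 \<and> j \<in> {2, 4} \<or> i = 4 \<and> j \<in> {3, 0}"
  unfolding adjacent_in_def length_pentagon
  by (cases "i < 5") (auto simp: pentagon_def elim: less_5_cases)

lemma adjacency_lists_K2: "adjacency_lists single_edge"
  by (auto simp: adjacency_lists_def single_edge_def less_Suc_eq)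

lemma adjacency_lists_C5: "adjacency_lists pentagon"
  unfolding adjacency_lists_def length_pentagon ball_lessThan_5 by (simp add: pentagon_def)

lemma symp_K2: "symp K2"
  by (auto simp: symp_def K2_iff)

lemma symp_C5: "symp C5"
  by (auto simp: symp_def C5_iff)

lemma set_letters_of_K2: "set_mset (letters_of [7, 8]) = {0, 1}"
  by (auto simp: set_letters_of less_Suc_eq)

lemma replicate_5_3: "[3, 3, 3, 3, 3] = replicate 5 (3::nat)"
  by (simp add: numeral_eq_Suc)

lemma set_letters_of_C5: "set_mset (letters_of [3, 3, 3, 3, 3]) = {..<5}"
  by (auto simp: replicate_5_3 set_letters_of)

lemma twin_free_K2: "twin_free_on (set_mset (letters_of [7, 8])) K2"
  by (simp add: set_letters_of_K2 twin_free_on_def K2_iff)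

lemma twin_free_C5: "twin_free_on (set_mset (letters_of [3, 3, 3, 3, 3])) C5"
  unfolding set_letters_of_C5 lessThan_5
  by (simp add: twin_free_on_def C5_iff)

text \<open>Exchanging the two classes is excluded by their different sizes.\<close>

lemma pattern_symmetries_K2: "pattern_symmetries K2 (letters_of [7, 8]) = {id}"
proof -
  have "\<pi> = id" if "\<pi> permutes {0, 1}" "image_mset \<pi> (letters_of [7, 8]) = letters_of [7, 8]" for \<pi>
  proof -
    have "\<pi> 0 \<in> {0, 1}" "\<pi> 1 \<in> {0, 1}"
      unfolding permutes_in_image[OF that(1)] by simp_all
    moreover have "\<pi> 1 \<noteq> \<pi> 0"
      using permutes_inj[OF that(1)] by (simp add: inj_eq)
    moreover have "\<pi> 0 \<noteq> 1"
    proof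
      assume "\<pi> 0 = 1"
      with calculation have "\<pi> 1 = 0" by auto
      with \<open>\<pi> 0 = 1\<close> have "count (image_mset \<pi> (letters_of [7, 8])) 0 = 8"
        by (simp add: letters_of_def)
      then show False unfolding that(2) by (simp add: count_letters_of)
    qed
    ultimately have "\<pi> 0 = 0" "\<pi> 1 = 1" by auto
    moreover have "\<pi> i = i" if "i \<notin> {0, 1}" for i
      using permutes_not_in[OF \<open>\<pi> permutes {0, 1}\<close> that] .
    ultimately show ?thesis
      unfolding fun_eq_iff id_apply by (metis insert_iff singleton_iff)
  qed
  then show ?thesis
    unfolding pattern_symmetries_def set_letters_of_K2 by (auto simp: permutes_id)
qed

text \<open>The value lists of the rotations and reflections of the pentagon.\<close>

definition dihedral_words :: "nat list list" where
  "dihedral_words =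
     [[0, 1, 2, 3, 4], [1, 2, 3, 4, 0], [2, 3, 4, 0, 1], [3, 4, 0, 1, 2], [4, 0, 1, 2, 3],
      [0, 4, 3, 2, 1], [1, 0, 4, 3, 2], [2, 1, 0, 4, 3], [3, 2, 1, 0, 4], [4, 3, 2, 1, 0]]"

lemma C5_pairs:
  assumes "C5 a b"
  shows "(a, b) \<in> {(0, 1), (0, 4), (1, 0), (1, 2), (2, 1), (2, 3), (3, 2), (3, 4), (4, 3), (4, 0)}"
  using assms unfolding C5_iff by auto

text \<open>A walk in the 5-cycle that does not turn back keeps its direction \<open>b - a\<close>, so it continues with
  \<open>2 * b - a\<close> modulo 5.\<close>

lemma C5_walk_next:
  assumes "C5 a b" "C5 b c" "c \<noteq> a"
  shows "c = (2 * b + 4 * a) mod 5"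
  using C5_pairs[OF assms(1)] assms(2,3) unfolding C5_iff by (elim insertE) auto

lemma dihedral_wordsI:
  assumes "C5 a b" "C5 b c" "C5 c d" "C5 d e" and "c \<noteq> a" "d \<noteq> b" "e \<noteq> c"
  shows "[a, b, c, d, e] \<in> set dihedral_words"
proof -
  have "c = (2 * b + 4 * a) mod 5" "d = (2 * c + 4 * b) mod 5" "e = (2 * d + 4 * c) mod 5"
    using assms by (blast intro: C5_walk_next)+
  then show ?thesis
    using C5_pairs[OF assms(1)] unfolding dihedral_words_def by (elim insertE) simp_all
qed

text \<open>All classes have the same size, so all automorphisms of the 5-cycle count. An automorphism maps
  the walk \<open>0, 1, 2, 3, 4\<close> to a walk that does not turn back, which is determined by its first two
  vertices; conversely each of the ten such walks comes from an automorphism.\<close>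

lemma card_pattern_symmetries_C5:
  "card (pattern_symmetries C5 (letters_of [3, 3, 3, 3, 3])) = 10"
proof -
  let ?Q = "pattern_symmetries C5 (letters_of [3, 3, 3, 3, 3])"
  let ?tuple = "\<lambda>\<pi>. map \<pi> [0, 1, 2, 3, 4::nat]"
  have "inj_on ?tuple ?Q"
  proof (rule inj_onI, rule ext)
    fix \<pi> \<rho> i assume "\<pi> \<in> ?Q" "\<rho> \<in> ?Q" "?tuple \<pi> = ?tuple \<rho>"
    then show "\<pi> i = \<rho> i"
      by (cases "i < 5")
         (auto simp: pattern_symmetries_def set_letters_of_C5 permutes_not_in elim: less_5_cases)
  qed
  moreover have "?tuple ` ?Q = set dihedral_words"
  proof (intro equalityI subsetI)
    fix xs assume "xs \<in> ?tuple ` ?Q"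
    then obtain \<pi> where perm: "\<pi> permutes {..<5}" and xs: "xs = ?tuple \<pi>"
      and adj: "\<And>i j. i < 5 \<Longrightarrow> j < 5 \<Longrightarrow> C5 (\<pi> i) (\<pi> j) \<longleftrightarrow> C5 i j"
      by (auto simp: pattern_symmetries_def set_letters_of_C5)
    have inj: "\<pi> i = \<pi> j \<longleftrightarrow> i = j" for i j
      using permutes_inj[OF perm] by (auto dest: injD)
    have "C5 (\<pi> 0) (\<pi> 1)" "C5 (\<pi> 1) (\<pi> 2)" "C5 (\<pi> 2) (\<pi> 3)" "C5 (\<pi> 3) (\<pi> 4)"
      by (simp_all add: adj) (simp_all add: C5_iff)
    moreover have "\<pi> 2 \<noteq> \<pi> 0" "\<pi> 3 \<noteq> \<pi> 1" "\<pi> 4 \<noteq> \<pi> 2"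
      by (simp_all add: inj)
    ultimately show "xs \<in> set dihedral_words"
      unfolding xs list.map by (rule dihedral_wordsI)
  next
    fix xs assume xs: "xs \<in> set dihedral_words"
    define \<pi> where "\<pi> i = (if i < 5 then xs ! i else i)" for i
    have word: "distinct xs" "set xs = {..<5}" "length xs = 5"
      using xs unfolding lessThan_5 by (auto simp: dihedral_words_def)
    have "inj_on \<pi> {..<5}"
      using nth_eq_iff_index_eq[OF word(1)] word(3) by (simp add: inj_on_def \<pi>_def)
    moreover have "\<pi> ` {..<5} = (!) xs ` {..<length xs}"
      by (rule image_cong) (simp_all add: \<pi>_def word)
    then have "\<pi> ` {..<5} = {..<5}" by (simp only: nth_image_lessThan word(2))
    ultimately have perm: "\<pi> permutes {..<5}"
      by (intro bij_imp_permutes) (simp_all add: bij_betw_def \<pi>_def)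
    have letters_of: "letters_of [3, 3, 3, 3, 3] = (\<Sum>i<5. replicate_mset 3 i)"
      unfolding replicate_5_3 letters_of_def by simp
    have "image_mset \<pi> (letters_of [3, 3, 3, 3, 3]) = (\<Sum>i<5. replicate_mset 3 (\<pi> i))"
      using sum_comp_morphism[of "image_mset \<pi>" "replicate_mset 3" "{..<5}"]
      by (simp add: letters_of comp_def)
    also have "\<dots> = letters_of [3, 3, 3, 3, 3]"
      using sum.permute[OF perm, of "replicate_mset 3"] by (simp add: letters_of comp_def)
    finally have mset: "image_mset \<pi> (letters_of [3, 3, 3, 3, 3]) = letters_of [3, 3, 3, 3, 3]" .
    have "\<forall>i<5. \<forall>j<5. C5 (xs ! i) (xs ! j) \<longleftrightarrow> C5 i j"
      using xs unfolding ball_lessThan_5 dihedral_words_def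
      by (simp, elim disjE) (simp_all add: C5_iff)
    then have "\<pi> \<in> ?Q"
      using perm mset by (simp add: pattern_symmetries_def set_letters_of_C5 \<pi>_def)
    moreover have "?tuple \<pi> = xs"
      using xs by (auto simp: dihedral_words_def \<pi>_def)
    ultimately show "xs \<in> ?tuple ` ?Q" by blast
  qed
  ultimately have "card ?Q = card (set dihedral_words)"
    by (metis card_image)
  also have "\<dots> = 10"
    by (subst distinct_card) (simp_all add: dihedral_words_def)
  finally show ?thesis .
qed

lemma coloured_by_complete_bipartite: "coloured_by K2 (letters_of [7, 8]) (complete_bipartite 7 8)"
proof (rule coloured_byI[where c = "\<lambda>v. if v < 7 then 0 else 1 :: nat"])
  fix i :: nat
  have "{v \<in> verts (complete_bipartite 7 8). (if v < 7 then 0 else 1 :: nat) = i}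
      = (if i = 0 then {..<7} else if i = 1 then {7..<15} else {})"
    by (auto simp: complete_bipartite_def)
  then show "card {v \<in> verts (complete_bipartite 7 8). (if v < 7 then 0 else 1 :: nat) = i}
      = count (letters_of [7, 8]) i"
    by (auto simp: count_letters_of less_Suc_eq)
next
  fix u v assume uv: "u \<in> verts (complete_bipartite 7 8)" "v \<in> verts (complete_bipartite 7 8)"
  have "{u, v} \<in> edges (complete_bipartite 7 8) \<longleftrightarrow>
      u < 7 \<and> 7 \<le> v \<and> v < 15 \<or> v < 7 \<and> 7 \<le> u \<and> u < 15"
    unfolding complete_bipartite_def by (simp add: doubleton_eq_iff) blast
  then show "{u, v} \<in> edges (complete_bipartite 7 8) \<longleftrightarrow>
      K2 (if u < 7 then 0 else 1 :: nat) (if v < 7 then 0 else 1 :: nat)"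
    using uv by (auto simp: complete_bipartite_def K2_iff)
qed (simp add: complete_bipartite_def)

lemma edges_cycle_graph_5: "edges (cycle_graph 5) = {{0, 1}, {1, 2}, {2, 3}, {3, 4}, {4, 0}}"
proof -
  have "edges (cycle_graph 5) = (\<lambda>i. {i, Suc i mod 5}) ` {..<5}"
    by (auto simp: cycle_graph_def)
  then show ?thesis unfolding lessThan_5 by (simp add: numeral_2_eq_2)
qed

lemma coloured_by_blow_up: "coloured_by C5 (letters_of [3, 3, 3, 3, 3]) (blow_up (cycle_graph 5) 3)"
proof (rule coloured_byI[where c = fst])
  have V: "verts (blow_up (cycle_graph 5) 3) = {..<5} \<times> {..<3}"
    by (simp add: blow_up_def cycle_graph_def)
  show "finite (verts (blow_up (cycle_graph 5) 3))" by (simp add: V)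
  fix i :: nat
  have "{v \<in> {..<5} \<times> {..<3::nat}. fst v = i} = (if i < 5 then {i} \<times> {..<3} else {})"
    by auto
  then show "card {v \<in> verts (blow_up (cycle_graph 5) 3). fst v = i}
      = count (letters_of [3, 3, 3, 3, 3]) i"
    unfolding V by (simp add: replicate_5_3 count_letters_of card_cartesian_product)
next
  fix x y assume "x \<in> verts (blow_up (cycle_graph 5) 3)" "y \<in> verts (blow_up (cycle_graph 5) 3)"
  then obtain u i v j where xy: "x = (u, i)" "y = (v, j)" "u < 5" "v < 5" "i < 3" "j < 3"
    by (auto simp: blow_up_def cycle_graph_def)
  have "{x, y} \<in> edges (blow_up (cycle_graph 5) 3) \<longleftrightarrow> {u, v} \<in> edges (cycle_graph 5)"
    using xy by (auto simp: blow_up_def doubleton_eq_iff insert_commute)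
  also have "\<dots> \<longleftrightarrow> C5 u v"
    using xy(3,4) unfolding edges_cycle_graph_5
    by (elim less_5_cases) (simp_all add: C5_iff doubleton_eq_iff)
  finally show "{x, y} \<in> edges (blow_up (cycle_graph 5) 3) \<longleftrightarrow> C5 (fst x) (fst y)"
    by (simp add: xy)
qed

lemma prod_fact_15:
  "(\<Prod>t=1..15. fact t) = (90378331112371142262979521568630736335023247731599748366336000000000000000000::real)"
proof -
  have "(\<Prod>t=1..numeral k. fact t) = (\<Prod>t=1..pred_numeral k. fact t) * (fact (numeral k) :: real)" for k
    by (simp add: numeral_eq_Suc)
  then show ?thesis by (simp add: fact_numeral)
qed

section \<open>Evaluation\<close>

text \<open>The defining equations in conditional form. Here a comparison of two vectors is decided before the
  equation is applied; with \<open>if\<close> on the right-hand side, the remaining tables would be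
  traversed again after every comparison.\<close>

lemma merge_tables_same: "merge_tables ((s, a) # X) ((s, b) # Y) = (s, a + b) # merge_tables X Y"
  by simp

lemma merge_tables_less:
  "lex_less s t \<Longrightarrow> s \<noteq> t \<Longrightarrow> merge_tables ((s, a) # X) ((t, b) # Y) = (s, a) # merge_tables X ((t, b) # Y)"
  by simp

lemma merge_tables_greater:
  "\<not> lex_less s t \<Longrightarrow> s \<noteq> t \<Longrightarrow> merge_tables ((s, a) # X) ((t, b) # Y) = (t, b) # merge_tables ((s, a) # X) Y"
  by simp

lemma peel_letter_absent:
  "s ! i = 0 \<Longrightarrow> peel_letter N t i ((s, a) # X) = peel_letter N t i X"
  by simp

lemma peel_letter_present:
  "s ! i \<noteq> 0 \<Longrightarrow> peel_letter N t i ((s, a) # X) =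
     (let d = sum_list (map ((!) s) (N ! i))
      in (s[i := s ! i - 1], a * (fact d * fact (t - d)))) # peel_letter N t i X"
  by (simp add: Let_def)

lemma peel_all_numeral:
  "peel_all N (numeral k) X = peel_all N (pred_numeral k) (peel N (pred_numeral k) X)"
  by (simp add: numeral_eq_Suc)

lemmas peel_all_rules = peel_all_numeral peel_def upt_rec merge_tables_same merge_tables_less merge_tables_greater
  peel_letter_absent peel_letter_present Let_def fact_numeral

lemma peel_all_K2:
  "peel_all single_edge 15 [([7, 8], 1)] =
     [([0, 0], 660332825214221847966115457541594211260825600000000)]"
  unfolding single_edge_def by (simp add: peel_all_rules del: merge_tables.simps(3) peel_letter.simps(2))

lemma peel_all_C5:
  "peel_all pentagon 15 [([3, 3, 3, 3, 3], 1)] =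
     [([0, 0, 0, 0, 0], 1329144056943490721063494767085526823469056000000000)]"
  unfolding pentagon_def by (simp add: peel_all_rules del: merge_tables.simps(3) peel_letter.simps(2))

lemma likelihood_K2:
  assumes "coloured_by K2 (letters_of [7, 8]) G"
  shows "likelihood G = 7628328998218493 / 1044072954894268925604163831726080000000000"
proof -
  have "total_history_weight K2 (letters_of [7, 8]) =
      660332825214221847966115457541594211260825600000000"
    using peel_all_K2
    by (intro total_history_weight_by_peeling[OF adjacency_lists_K2]) (simp_all add: single_edge_def)
  \<comment> \<open>The factor is \<open>1! * 2! * \<dots> * 15!\<close>; an edge with unequal classes has only the identity as symmetry.\<close>
  then have "likelihood G * 90378331112371142262979521568630736335023247731599748366336000000000000000000
      = 660332825214221847966115457541594211260825600000000"
    using likelihood_coloured[OF symp_K2 irreflp_adjacent_in[OF adjacency_lists_K2] twin_free_K2 assms]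
    by (simp add: pattern_symmetries_K2 size_letters_of prod_fact_15[simplified])
  then show ?thesis by simp
qed

lemma likelihood_C5:
  assumes "coloured_by C5 (letters_of [3, 3, 3, 3, 3]) G"
  shows "likelihood G = 63977511069907 / 43503039787261205233506826321920000000000"
proof -
  have "total_history_weight C5 (letters_of [3, 3, 3, 3, 3]) =
      1329144056943490721063494767085526823469056000000000"
    using peel_all_C5
    by (intro total_history_weight_by_peeling[OF adjacency_lists_C5]) (simp_all add: pentagon_def)
  \<comment> \<open>The factor is \<open>10 * (1! * 2! * \<dots> * 15!)\<close>, with 10 for the symmetries of the 5-cycle.\<close>
  then have "likelihood G * 903783311123711422629795215686307363350232477315997483663360000000000000000000
      = 1329144056943490721063494767085526823469056000000000"
    using likelihood_coloured[OF symp_C5 irreflp_adjacent_in[OF adjacency_lists_C5] twin_free_C5 assms]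
    by (simp add: card_pattern_symmetries_C5 size_letters_of prod_fact_15[simplified])
  then show ?thesis by simp
qed

theorem theorem5:
  shows "let B = complete_bipartite 7 8; C = blow_up (cycle_graph 5) 3 in
      \<not> (\<forall>G :: nat graph. simple_graph G \<and> order G = 15 \<longrightarrow> likelihood B \<le> likelihood G) \<and>
      likelihood C = 63977511069907 / 43503039787261205233506826321920000000000 \<and>
      1.4706 / 10 ^ 27 \<le> likelihood C \<and> likelihood C < 1.4707 / 10 ^ 27 \<and>
      likelihood B = 7628328998218493 / 1044072954894268925604163831726080000000000 \<and>
      7.3063 / 10 ^ 27 \<le> likelihood B \<and> likelihood B < 7.3064 / 10 ^ 27 \<and>
      likelihood C / likelihood B = 1535460265677768 / 7628328998218493 \<and>
      0.20128 \<le> likelihood C / likelihood B \<and> likelihood C / likelihood B < 0.20129 \<and>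
      likelihood C / likelihood B < 1"
proof -
  obtain G :: "nat graph" where G: "simple_graph G" "order G = 15"
    and col: "coloured_by C5 (letters_of [3, 3, 3, 3, 3]) G"
    using ex_nat_graph_coloured_by[OF symp_C5 irreflp_adjacent_in[OF adjacency_lists_C5],
        of "letters_of [3, 3, 3, 3, 3]"]
    by (auto simp: size_letters_of)
  note likelihoods = likelihood_K2[OF coloured_by_complete_bipartite] likelihood_C5[OF coloured_by_blow_up]
  have "\<not> likelihood (complete_bipartite 7 8) \<le> likelihood G"
    unfolding likelihoods likelihood_C5[OF col] by simp
  then have "\<not> (\<forall>G :: nat graph. simple_graph G \<and> order G = 15 \<longrightarrow>
      likelihood (complete_bipartite 7 8) \<le> likelihood G)"
    using G by blast
  then show ?thesis
    unfolding Let_def likelihoods by (intro conjI) simp_all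
qed

end
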